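(* Let $\langle X,\tau\rangle$ be a topological space, let $\mathcal{I}$ be the ideal of countable (i.e. at most countable) subsets of $X$, let $\sigma$ be the topology on $X$ obtained from $\tau$ and $\mathcal{I}$ by means of the local closure function, and let $\tau_\omega$ be the topology of $\omega$-open subsets of $X$. Then $\sigma \subseteq \tau_\omega$.
   Context: Let $\langle X,\tau\rangle$ be a topological space. For $x\in X$, $\tau(x)$ denotes the family of open neighbourhoods of $x$ in $\tau$, and $\mathrm{Cl}$ denotes closure in $\tau$. "Countable" means of cardinality at most $\aleph_0$; the family of all countable subsets of $X$ is an ideal on $X$, denoted here by $\mathcal{I}$ (it contains $\emptyset$ and is closed under subsets and finite unions). The local closure function of $\langle X,\tau,\mathcal{I}\rangle$ assigns to each $A\subseteq X$ the set $$\Gamma(A)=\{x\in X : \mathrm{Cl}(U)\cap A\notin\mathcal{I}\text{ for each }U\in\tau(x)\}.$$ Put $\psi_\Gamma(A)=X\setminus\Gamma(X\setminus A)$. The topology $\sigma$ is defined by: $A\in\sigma$ if and only if $A\subseteq\psi_\Gamma(A)$ (equivalently, $\Gamma(X\setminus A)\subseteq X\setminus A$). A set is $\omega$-closed if it contains all of its $\omega$-accumulation points (points each of whose open neighbourhoods meets the set in an uncountable set), and $\omega$-open if its complement is $\omega$-closed. The family of all $\omega$-open sets is a topology on $X$, denoted $\tau_\omega$; equivalently, $A\in\tau_\omega$ if and only if for every $x\in A$ there exists $U\in\tau(x)$ with $|U\setminus A|\le\aleph_0$. *)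

theory Defs
  imports "HOL-Analysis.Analysis"
begin

definition set_ideal_on :: "'a set \<Rightarrow> 'a set set \<Rightarrow> bool" where
  "set_ideal_on X I \<longleftrightarrow> I \<subseteq> Pow X \<and> {} \<in> I \<and>
     (\<forall>A\<in>I. \<forall>B. B \<subseteq> A \<longrightarrow> B \<in> I) \<and> (\<forall>A\<in>I. \<forall>B\<in>I. A \<union> B \<in> I)"

definition countable_ideal :: "'a set \<Rightarrow> 'a set set" where
  "countable_ideal X = {A. A \<subseteq> X \<and> countable A}"

definition local_closure :: "'a topology \<Rightarrow> 'a set set \<Rightarrow> 'a set \<Rightarrow> 'a set" where
  "local_closure T I A =
     {x \<in> topspace T. \<forall>U. openin T U \<and> x \<in> U \<longrightarrow> (T closure_of U) \<inter> A \<notin> I}"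

definition psi_local :: "'a topology \<Rightarrow> 'a set set \<Rightarrow> 'a set \<Rightarrow> 'a set" where
  "psi_local T I A = topspace T - local_closure T I (topspace T - A)"

(* The constructor topology is meaningful only on families satisfying istopology;
   for an ideal this is established in openin_sigma_topology below. *)
definition sigma_topology :: "'a topology \<Rightarrow> 'a set set \<Rightarrow> 'a topology" where
  "sigma_topology T I = topology (\<lambda>A. A \<subseteq> topspace T \<and> A \<subseteq> psi_local T I A)"

definition omega_accumulation_point :: "'a topology \<Rightarrow> 'a set \<Rightarrow> 'a \<Rightarrow> bool" where
  "omega_accumulation_point T A x \<longleftrightarrow>
     x \<in> topspace T \<and> (\<forall>U. openin T U \<and> x \<in> U \<longrightarrow> uncountable (U \<inter> A))"

definition omega_closed :: "'a topology \<Rightarrow> 'a set \<Rightarrow> bool" where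
  "omega_closed T A \<longleftrightarrow>
     A \<subseteq> topspace T \<and> (\<forall>x. omega_accumulation_point T A x \<longrightarrow> x \<in> A)"

definition omega_open :: "'a topology \<Rightarrow> 'a set \<Rightarrow> bool" where
  "omega_open T A \<longleftrightarrow> A \<subseteq> topspace T \<and> omega_closed T (topspace T - A)"

definition omega_topology :: "'a topology \<Rightarrow> 'a topology" where
  "omega_topology T = topology (omega_open T)"

lemma set_ideal_on_countable_ideal: "set_ideal_on X (countable_ideal X)"
  unfolding set_ideal_on_def countable_ideal_def by (auto intro: countable_subset)

lemma local_closure_mono:
  assumes "set_ideal_on X I" "A \<subseteq> B"
  shows "local_closure T I A \<subseteq> local_closure T I B"
proof -
  have "C \<inter> A \<in> I" if "C \<inter> B \<in> I" for C
  proof -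
    have "C \<inter> A \<subseteq> C \<inter> B" using assms(2) by blast
    with that assms(1) show ?thesis unfolding set_ideal_on_def by blast
  qed
  then show ?thesis unfolding local_closure_def by blast
qed

lemma local_closure_Un:
  assumes "set_ideal_on X I"
  shows "local_closure T I (A \<union> B) \<subseteq> local_closure T I A \<union> local_closure T I B"
proof
  fix x assume x: "x \<in> local_closure T I (A \<union> B)"
  show "x \<in> local_closure T I A \<union> local_closure T I B"
  proof (rule ccontr)
    assume "\<not> ?thesis"
    moreover have "x \<in> topspace T" using x by (simp add: local_closure_def)
    ultimately obtain U V where
      U: "openin T U" "x \<in> U" "(T closure_of U) \<inter> A \<in> I" and
      V: "openin T V" "x \<in> V" "(T closure_of V) \<inter> B \<in> I"
      unfolding local_closure_def by blast
    let ?W = "U \<inter> V"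
    have "T closure_of ?W \<subseteq> T closure_of U" "T closure_of ?W \<subseteq> T closure_of V"
      by (simp_all add: closure_of_mono)
    then have "(T closure_of ?W) \<inter> (A \<union> B)
        \<subseteq> ((T closure_of U) \<inter> A) \<union> ((T closure_of V) \<inter> B)"
      by blast
    moreover have "((T closure_of U) \<inter> A) \<union> ((T closure_of V) \<inter> B) \<in> I"
      using assms U(3) V(3) unfolding set_ideal_on_def by blast
    ultimately have "(T closure_of ?W) \<inter> (A \<union> B) \<in> I"
      using assms unfolding set_ideal_on_def by blast
    moreover have "openin T ?W" "x \<in> ?W" using U V by auto
    ultimately show False using x unfolding local_closure_def by blast
  qed
qed

lemma openin_sigma_topology:
  assumes "set_ideal_on (topspace T) I"
  shows "openin (sigma_topology T I) A \<longleftrightarrow> A \<subseteq> topspace T \<and> A \<subseteq> psi_local T I A"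
proof -
  let ?X = "topspace T"
  let ?P = "\<lambda>A. A \<subseteq> ?X \<and> A \<subseteq> psi_local T I A"
  have "?P (A \<inter> B)" if A: "?P A" and B: "?P B" for A B
  proof -
    have "local_closure T I (?X - A \<inter> B)
        \<subseteq> local_closure T I (?X - A) \<union> local_closure T I (?X - B)"
      using local_closure_Un[OF assms, of T "?X - A" "?X - B"] by (simp add: Diff_Int)
    then show ?thesis using A B unfolding psi_local_def by blast
  qed
  moreover have "?P (\<Union>K)" if K: "\<forall>A\<in>K. ?P A" for K
  proof -
    have "local_closure T I (?X - \<Union>K) \<subseteq> local_closure T I (?X - A)" if "A \<in> K" for A
      using that by (intro local_closure_mono[OF assms]) blast
    then show ?thesis using K unfolding psi_local_def by blast
  qed
  ultimately have "istopology ?P" unfolding istopology_def by blast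
  then show ?thesis unfolding sigma_topology_def by (simp add: topology_inverse')
qed

lemma omega_open_iff:
  "omega_open T A \<longleftrightarrow>
     A \<subseteq> topspace T \<and> (\<forall>x\<in>A. \<exists>U. openin T U \<and> x \<in> U \<and> countable (U - A))"
proof -
  have "U \<inter> (topspace T - A) = U - A" if "openin T U" for U
    using openin_subset[OF that] by blast
  then show ?thesis
    unfolding omega_open_def omega_closed_def omega_accumulation_point_def
    by (smt (verit) Diff_iff Diff_subset subsetD)
qed

lemma openin_omega_topology: "openin (omega_topology T) A \<longleftrightarrow> omega_open T A"
proof -
  have "omega_open T (A \<inter> B)" if A: "omega_open T A" and B: "omega_open T B" for A B
    unfolding omega_open_iff
  proof (intro conjI ballI)
    show "A \<inter> B \<subseteq> topspace T" using A by (auto simp: omega_open_iff)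
    fix x assume "x \<in> A \<inter> B"
    then obtain U V where
      "openin T U" "x \<in> U" "countable (U - A)" "openin T V" "x \<in> V" "countable (V - B)"
      using A B unfolding omega_open_iff by blast
    moreover have "U \<inter> V - A \<inter> B \<subseteq> (U - A) \<union> (V - B)" by blast
    ultimately show "\<exists>U. openin T U \<and> x \<in> U \<and> countable (U - A \<inter> B)"
      by (intro exI[of _ "U \<inter> V"]) (auto intro: countable_subset)
  qed
  moreover have "omega_open T (\<Union>K)" if K: "\<forall>A\<in>K. omega_open T A" for K
    unfolding omega_open_iff
  proof (intro conjI ballI)
    show "\<Union>K \<subseteq> topspace T" using K by (auto simp: omega_open_iff)
    fix x assume "x \<in> \<Union>K"
    then obtain A where A: "A \<in> K" "x \<in> A" by blast
    then obtain U where U: "openin T U" "x \<in> U" "countable (U - A)"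
      using K unfolding omega_open_iff by blast
    have "U - \<Union>K \<subseteq> U - A" using A by blast
    with U show "\<exists>U. openin T U \<and> x \<in> U \<and> countable (U - \<Union>K)"
      by (blast intro: countable_subset)
  qed
  ultimately have "istopology (omega_open T)" unfolding istopology_def by blast
  then show ?thesis unfolding omega_topology_def by (simp add: topology_inverse')
qed

end

theory Submission
  imports Defs
begin

text \<open>
  The neighbourhood \<open>U\<close> of a point of \<open>A\<close> that witnesses \<open>\<sigma>\<close>-openness there also
  witnesses \<open>\<omega>\<close>-openness: an open set is contained in its closure, so it meets the complement
  of \<open>A\<close> in no more points than its closure does.
\<close>

theorem theorem1:
  fixes T :: "'a topology"
  shows "{A. openin (sigma_topology T (countable_ideal (topspace T))) A}
           \<subseteq> {A. openin (omega_topology T) A}"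
proof (intro subsetI CollectI, elim CollectE)
  let ?X = "topspace T"
  fix A assume "openin (sigma_topology T (countable_ideal ?X)) A"
  then have A: "A \<subseteq> ?X" "A \<subseteq> psi_local T (countable_ideal ?X) A"
    by (simp_all add: openin_sigma_topology[OF set_ideal_on_countable_ideal])
  have "\<exists>U. openin T U \<and> x \<in> U \<and> countable (U - A)" if "x \<in> A" for x
  proof -
    have "x \<in> ?X" "x \<notin> local_closure T (countable_ideal ?X) (?X - A)"
      using A that unfolding psi_local_def by blast+
    then obtain U where U: "openin T U" "x \<in> U"
      and ctble: "countable ((T closure_of U) \<inter> (?X - A))"
      unfolding local_closure_def countable_ideal_def by blast
    have "U - A \<subseteq> (T closure_of U) \<inter> (?X - A)"
      using openin_subset[OF U(1)] closure_of_subset[of U T] by blast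
    then have "countable (U - A)"
      using ctble by (rule countable_subset)
    with U show ?thesis by blast
  qed
  with A(1) show "openin (omega_topology T) A"
    by (simp add: openin_omega_topology omega_open_iff)
qed

end
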